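(* Let $n\ge 1$ and $I=\{i_1<\dots<i_l\}\subseteq\{0,\dots,n-1\}$, and set $i_{l+1}=n$. Let $j_t=i_{t+1}-i_t$ for $1\le t\le l$. If there exists $m\in\{1,\dots,l\}$ with $j_m$ odd, let $m$ be the largest such index; then $$f_{n,I}(X)=-X^n f_{n-1,I^{(m+1)}}(X)+\sum_{t=m}^{l}X^{n-i_{t+1}}f_{n-1,I^{(t+1)}}(X).$$ If no such $m$ exists, then $$f_{n,I}(X)=\sum_{t=0}^{l}X^{n-i_{t+1}}f_{n-1,I^{(t+1)}}(X).$$
   Context: Polynomials in $X$: $(\underline{k})=1-X^k$ for $k>0$, $(\underline 0)=1$; $(\underline{k})!=\prod_{i=1}^k(\underline i)$; $(\underline k)!!=\prod_{1\le i\le k,\ i\text{ even}}(\underline i)$. For an integer $N\ge0$ and a finite set of integers $K=\{k_1<\dots<k_l\}$ with $l\ge1$ and $k_l\le N$: if $k_1<0$ set $f_{N,K}=0$; otherwise, with $d_t=k_{t+1}-k_t$ ($1\le t<l$) and $d_l=N-k_l$, set $f_{N,K}(X)=\frac{(\underline N)!}{(\underline{k_1})!\prod_{t=1}^l(\underline{d_t})!!}$. Also $f_{N,\emptyset}=1$. For $k\in\{1,\dots,l+1\}$ define $I^{(k)}$ by: $I^{(l+1)}=I$; for $k\le l$, if $k=1$ or $i_k-1\ne i_{k-1}$ then $I^{(k)}=\{i_1,\dots,i_{k-1},i_k-1,\dots,i_l-1\}$, and otherwise $I^{(k)}=\{i_1,\dots,i_{k-2},i_k-1,\dots,i_l-1\}$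 (the repeated value is listed once). *)

theory Defs
  imports "HOL-Computational_Algebra.Computational_Algebra"
begin

definition qint :: "nat \<Rightarrow> int poly" where
  "qint k = (if k = 0 then 1 else 1 - monom 1 k)"

definition qfact :: "nat \<Rightarrow> int poly" where
  "qfact k = (\<Prod>i = 1..k. qint i)"

definition qdfact :: "nat \<Rightarrow> int poly" where
  "qdfact k = (\<Prod>i \<in> {i \<in> {1..k}. even i}. qint i)"

text \<open>For \<open>K = {k\<^sub>1 < \<dots> < k\<^sub>l}\<close> the value \<open>elt N K t\<close> is \<open>k\<^sub>t\<close> when \<open>1 \<le> t \<le> l\<close>, and the
  convention \<open>k\<^sub>l\<^sub>+\<^sub>1 = N\<close> is built in. Hence \<open>gap N K t\<close> is \<open>k\<^sub>t\<^sub>+\<^sub>1 - k\<^sub>t\<close> for \<open>t < l\<close> and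
  \<open>N - k\<^sub>l\<close> for \<open>t = l\<close>; it serves both as \<open>d\<^sub>t\<close> and as \<open>j\<^sub>t\<close>.\<close>

definition elt :: "nat \<Rightarrow> int set \<Rightarrow> nat \<Rightarrow> int" where
  "elt N K t = (if t \<le> card K then sorted_list_of_set K ! (t - 1) else int N)"

definition gap :: "nat \<Rightarrow> int set \<Rightarrow> nat \<Rightarrow> int" where
  "gap N K t = elt N K (t + 1) - elt N K t"

text \<open>The quotient is formed in the field of fractions of the integer polynomials, so no
  divisibility is presupposed. The definition is meaningful for finite \<open>K\<close> with all
  elements at most \<open>N\<close>.\<close>

definition fpol :: "nat \<Rightarrow> int set \<Rightarrow> int poly fract" where
  "fpol N K =
     (if K = {} then 1
      else if elt N K 1 < 0 then 0
      else to_fract (qfact N) /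
           to_fract (qfact (nat (elt N K 1)) * (\<Prod>t = 1..card K. qdfact (nat (gap N K t)))))"

definition indet :: "int poly fract" where
  "indet = to_fract (monom 1 1)"

text \<open>\<open>lowered n I k\<close> is \<open>I\<^bsup>(k)\<^esup>\<close> for \<open>1 \<le> k \<le> card I + 1\<close>; it does not depend on \<open>n\<close>,
  as only indices up to \<open>card I\<close> occur.\<close>

definition lowered :: "nat \<Rightarrow> int set \<Rightarrow> nat \<Rightarrow> int set" where
  "lowered n I k =
     (if k = card I + 1 then I
      else if k = 1 \<or> elt n I k - 1 \<noteq> elt n I (k - 1)
      then elt n I ` {1..k - 1} \<union> (\<lambda>t. elt n I t - 1) ` {k..card I}
      else elt n I ` {1..k - 2} \<union> (\<lambda>t. elt n I t - 1) ` {k..card I})"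

end

theory Submission
  imports Defs
begin

text \<open>
  Write \<open>i\<^sub>0 = 0\<close>, \<open>i\<^sub>l\<^sub>+\<^sub>1 = n\<close> and \<open>j\<^sub>t = i\<^sub>t\<^sub>+\<^sub>1 - i\<^sub>t\<close>. Passing from \<open>(n, I)\<close> to \<open>(n - 1, I\<^bsup>(t+1)\<^esup>)\<close>
  decreases \<open>n\<close> and the single gap \<open>j\<^sub>t\<close> by one and keeps all other gaps; a gap that becomes \<open>0\<close>
  contributes the factor \<open>1\<close>, so merging two equal elements is harmless. Hence
  \<open>(1 - X\<^bsup>n\<^esup>) f\<^bsub>n-1,I(t+1)\<^esub> = c\<^sub>t f\<^bsub>n,I\<^esub>\<close>, where \<open>c\<^sub>t = 1\<close> if \<open>t > 0\<close> and \<open>j\<^sub>t\<close> is odd, and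
  \<open>c\<^sub>t = 1 - X\<^bsup>j\<^sub>t\<^esup>\<close> otherwise. In the latter case
  \<open>X\<^bsup>n-i\<^sub>t\<^sub>+\<^sub>1\<^esup> c\<^sub>t = X\<^bsup>n-i\<^sub>t\<^sub>+\<^sub>1\<^esup> - X\<^bsup>n-i\<^sub>t\<^esup>\<close>, so after multiplication by \<open>1 - X\<^bsup>n\<^esup>\<close> both sums telescope.
\<close>

section \<open>Nonvanishing and one-step recursions of the X-factorials\<close>

lemma qint_nonzero: "qint k \<noteq> 0"
proof (cases "k = 0")
  case False
  then have "coeff (qint k) 0 = 1"
    by (simp add: qint_def)
  then show ?thesis
    by auto
qed (simp add: qint_def)

lemma qdfact_nonzero: "qdfact k \<noteq> 0"
  by (simp add: qdfact_def qint_nonzero)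

lemma qfact_Suc: "qfact (Suc k) = qfact k * qint (Suc k)"
  by (simp add: qfact_def)

lemma qdfact_0 [simp]: "qdfact 0 = 1"
  by (simp add: qdfact_def)

lemma qdfact_Suc: "qdfact (Suc k) = qdfact k * (if even (Suc k) then qint (Suc k) else 1)"
proof (cases "even (Suc k)")
  case True
  then have "{i \<in> {1..Suc k}. even i} = insert (Suc k) {i \<in> {1..k}. even i}"
    by (auto simp: le_Suc_eq)
  then show ?thesis
    using True by (simp add: qdfact_def mult.commute)
next
  case False
  then have "{i \<in> {1..Suc k}. even i} = {i \<in> {1..k}. even i}"
    by (auto simp: le_Suc_eq)
  then show ?thesis
    using False by (simp add: qdfact_def)
qed

text \<open>The exponent 0 is excluded because \<open>qint 0\<close> is 1, whereas 1 - X^0 =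
  0.\<close>

lemma to_fract_qint:
  assumes "k > 0"
  shows "to_fract (qint k) = 1 - indet ^ k"
proof -
  have "to_fract (p ^ k) = to_fract p ^ k" for p :: "int poly"
    by (induction k) simp_all
  then have "to_fract (monom 1 k :: int poly) = indet ^ k"
    unfolding indet_def by (simp flip: monom_power[of 1 1 k, simplified])
  then show ?thesis
    using assms by (simp add: qint_def)
qed

section \<open>Products of double factorials over consecutive differences of a list\<close>

text \<open>A list form of the denominator of \<open>fpol\<close>. Unlike a set, a list keeps
  repeated entries, so a lowered sequence can be handled before equal neighbours are merged.\<close>

fun gap_prod :: "int list \<Rightarrow> int poly" where
  "gap_prod (x # y # zs) = qdfact (nat (y - x)) * gap_prod (y # zs)"
| "gap_prod _ = 1"

lemma gap_prod_conv_nth: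
  "gap_prod xs = (\<Prod>t = 1..<length xs. qdfact (nat (xs ! t - xs ! (t - 1))))"
proof (induction xs rule: gap_prod.induct)
  case (1 x y zs)
  have "(\<Prod>t = 1..<length (x # y # zs). qdfact (nat ((x # y # zs) ! t - (x # y # zs) ! (t - 1)))) =
    qdfact (nat (y - x)) *
      (\<Prod>t = Suc 1..<Suc (length (y # zs)). qdfact (nat ((x # y # zs) ! t - (x # y # zs) ! (t - 1))))"
    by (subst prod.atLeast_Suc_lessThan) simp_all
  also have "(\<Prod>t = Suc 1..<Suc (length (y # zs)). qdfact (nat ((x # y # zs) ! t - (x # y # zs) ! (t - 1))))
    = (\<Prod>t = 1..<length (y # zs). qdfact (nat ((y # zs) ! t - (y # zs) ! (t - 1))))"
    unfolding prod.shift_bounds_Suc_ivl by (rule prod.cong) (auto simp: nth_Cons')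
  finally show ?case
    using 1 by simp
qed simp_all

lemma gap_prod_append:
  "gap_prod (us @ a # b # vs) = gap_prod (us @ [a]) * qdfact (nat (b - a)) * gap_prod (b # vs)"
proof (induction us)
  case (Cons u us)
  then show ?case
    by (cases us) (simp_all add: mult.assoc)
qed simp

text \<open>Only differences enter. This is why lowering a tail of the sequence together with n
  keeps all gaps inside that tail.\<close>

lemma gap_prod_map_minus: "gap_prod (map (\<lambda>x. x - c) xs) = gap_prod xs"
  by (induction xs rule: gap_prod.induct) simp_all

text \<open>A repetition contributes \<open>qdfact 0\<close>, which is 1. The last entry stands
  apart because N is appended after merging and may itself equal the largest element.\<close>

lemma gap_prod_remdups_adj_snoc: "gap_prod (remdups_adj xs @ [y]) = gap_prod (xs @ [y])"
proof (induction xs rule: remdups_adj.induct)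
  case (3 x y xs)
  show ?case
  proof (cases "x = y")
    case False
    obtain zs where "remdups_adj (y # xs) = y # zs"
      by (metis list.exhaust_sel hd_remdups_adj list.sel(1) remdups_adj_Nil_iff list.distinct(1))
    then show ?thesis
      using 3 False by simp
  qed (use 3 in simp)
qed simp_all

section \<open>Reading \<open>fpol\<close> and \<open>lowered\<close> off weakly sorted
  lists\<close>

lemma sorted_list_of_set_set_sorted:
  assumes "sorted xs"
  shows "sorted_list_of_set (set xs) = remdups_adj xs"
proof -
  have "distinct (remdups_adj xs)"
    using assms by (induction xs rule: remdups_adj.induct) auto
  then show ?thesis
    using assms sorted_list_of_set.idem_if_sorted_distinct[of "remdups_adj xs"] by simp
qed

text \<open>Appending N turns the convention k_{l+1} = N into ordinary list indexing; the shift by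
  one passes from 1-based to 0-based positions.\<close>

lemma elt_conv_nth:
  assumes "1 \<le> t" "t \<le> Suc (card K)"
  shows "elt N K t = (sorted_list_of_set K @ [int N]) ! (t - 1)"
  using assms by (auto simp: elt_def nth_append le_Suc_eq)

text \<open>Because repetitions are harmless in \<open>gap_prod\<close>, the list may have equal
  entries. Both branches of \<open>lowered\<close> are thereby covered by a single formula.\<close>

lemma fpol_set_sorted:
  assumes "sorted ys" "ys \<noteq> []"
  shows "fpol N (set ys) = (if hd ys < 0 then 0
    else to_fract (qfact N) / to_fract (qfact (nat (hd ys)) * gap_prod (ys @ [int N])))"
proof -
  define xs where "xs = remdups_adj ys"
  have xs: "sorted_list_of_set (set ys) = xs"
    using assms by (simp add: xs_def sorted_list_of_set_set_sorted)
  have len: "card (set ys) = length xs"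
    using xs by (metis length_sorted_list_of_set)
  have "xs \<noteq> []"
    using assms by (simp add: xs_def)
  have "elt N (set ys) 1 = hd ys"
    using assms \<open>xs \<noteq> []\<close> elt_conv_nth[of 1 "set ys" N]
    by (simp add: xs nth_append hd_conv_nth[symmetric]) (simp add: xs_def)
  moreover have "(\<Prod>t = 1..card (set ys). qdfact (nat (gap N (set ys) t))) = gap_prod (xs @ [int N])"
    unfolding gap_prod_conv_nth
  proof (rule prod.cong)
    fix t assume "t \<in> {1..<length (xs @ [int N])}"
    then show "qdfact (nat (gap N (set ys) t)) =
        qdfact (nat ((xs @ [int N]) ! t - (xs @ [int N]) ! (t - 1)))"
      using elt_conv_nth[of "Suc t" "set ys" N] elt_conv_nth[of t "set ys" N]
      by (simp add: gap_def xs len)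
  qed (auto simp: len)
  ultimately show ?thesis
    using assms by (simp add: fpol_def xs_def gap_prod_remdups_adj_snoc)
qed

text \<open>As sets, the branches in the definition of \<open>lowered\<close> all agree with this
  one list: the merging branch only avoids naming a repeated value twice.\<close>

lemma lowered_Suc:
  assumes "finite I" "t \<le> card I" "xs = sorted_list_of_set I"
  shows "lowered n I (Suc t) = set (take t xs @ map (\<lambda>x. x - 1) (drop t xs))"
proof -
  have len: "length xs = card I" and set: "set xs = I"
    using assms by simp_all
  have elt: "elt n I i = xs ! (i - 1)" if "i \<in> {1..card I}" for i
    using that assms by (simp add: elt_def)
  have take: "elt n I ` {1..i} = set (take i xs)" if "i \<le> card I" for i
  proof -
    have "elt n I ` {1..i} = (\<lambda>i. elt n I (Suc i)) ` {0..<i}"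
      using image_image[of "elt n I" Suc "{0..<i}"]
      by (simp only: image_Suc_atLeastLessThan atLeastLessThanSuc_atLeastAtMost One_nat_def)
    also have "\<dots> = (\<lambda>i. xs ! i) ` {0..<i}"
      using that by (intro image_cong) (simp_all add: elt)
    finally show ?thesis
      using that by (simp add: len nth_image)
  qed
  have drop: "(\<lambda>i. elt n I i - 1) ` {Suc t..card I} = (\<lambda>x. x - 1) ` set (drop t xs)"
  proof -
    have "(\<lambda>i. elt n I i - 1) ` {Suc t..card I} = (\<lambda>i. elt n I (Suc i) - 1) ` {t..<card I}"
      using image_image[of "\<lambda>i. elt n I i - 1" Suc "{t..<card I}"]
      by (simp only: image_Suc_atLeastLessThan atLeastLessThanSuc_atLeastAtMost)
    also have "\<dots> = (\<lambda>i. xs ! i - 1) ` {t..<card I}"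
      by (intro image_cong) (simp_all add: elt)
    also have "\<dots> = (\<lambda>x. x - 1) ` (\<lambda>i. xs ! i) ` {t..<card I}"
      by (simp add: image_image)
    also have "(\<lambda>i. xs ! i) ` {t..<card I} = set (drop t xs)"
    proof -
      have "(\<lambda>i. xs ! i) ` {t..<card I} = (\<lambda>i. xs ! (t + i)) ` {0..<card I - t}"
        using assms(2) image_image[of "(!) xs" "(+) t" "{0..<card I - t}"] by simp
      also have "\<dots> = (!) (drop t xs) ` {0..<card I - t}"
        using assms(2) by (intro image_cong) (simp_all add: len)
      finally show ?thesis
        using nth_image[of "card I - t" "drop t xs"] by (simp add: len)
    qed
    finally show ?thesis .
  qed
  show ?thesis
  proof (cases "t < card I \<and> t \<noteq> 0 \<and> elt n I (Suc t) - 1 = elt n I t")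
    case False
    show ?thesis
    proof (cases "t = card I")
      case True
      then show ?thesis
        by (simp add: lowered_def len set)
    next
      case neq: False
      then have "lowered n I (Suc t) = elt n I ` {1..t} \<union> (\<lambda>i. elt n I i - 1) ` {Suc t..card I}"
        using False assms(2) by (auto simp: lowered_def)
      then show ?thesis
        using assms(2) by (simp only: take drop) simp
    qed
  next
    case True
    then obtain s where s: "t = Suc s"
      by (cases t) auto
    \<comment> \<open>For k = \<open>Suc t\<close> the range {1..k-2} is {1..s}, one short of
      {1..t}. The omitted \<open>elt n I t\<close> reappears as the lowered value at index
      \<open>Suc t\<close>.\<close>
    have "lowered n I (Suc t) = elt n I ` {1..s} \<union> (\<lambda>i. elt n I i - 1) ` {Suc t..card I}"
      using True by (simp add: lowered_def s)
    also have "\<dots> = elt n I ` {1..t} \<union> (\<lambda>i. elt n I i - 1) ` {Suc t..card I}"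
    proof -
      have "elt n I t = elt n I (Suc t) - 1"
        using True by simp
      then have "elt n I t \<in> (\<lambda>i. elt n I i - 1) ` {Suc t..card I}"
        using True by (intro image_eqI[of _ _ "Suc t"]) auto
      moreover have "elt n I ` {1..t} = insert (elt n I t) (elt n I ` {1..s})"
        by (simp add: s atLeastAtMostSuc_conv)
      ultimately show ?thesis
        by auto
    qed
    finally show ?thesis
      using assms(2) by (simp only: take drop) simp
  qed
qed

text \<open>Distinct sorted integers differ by at least 1, so lowering a tail by 1 can create
  equality at the cut but no inversion.\<close>

lemma sorted_lower_drop:
  fixes xs :: "int list"
  assumes "sorted xs" "distinct xs"
  shows "sorted (take t xs @ map (\<lambda>x. x - 1) (drop t xs))"
proof -
  have "sorted_wrt (<) (take t xs @ drop t xs)"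
    using assms by (simp add: strict_sorted_iff)
  then have lt: "\<forall>x\<in>set (take t xs). \<forall>y\<in>set (drop t xs). x < y"
    and "sorted_wrt (<) (drop t xs)"
    unfolding sorted_wrt_append by auto
  then have "sorted (map (\<lambda>x. x - 1) (drop t xs))"
    by (auto simp: sorted_wrt_map intro: sorted_wrt_mono_rel[rotated])
  then show ?thesis
    using assms(1) lt by (force simp: sorted_append sorted_wrt_take)
qed

section \<open>The effect of lowering on f\<close>

context
  fixes n :: nat and I :: "int set"
  assumes n: "n \<ge> 1" and I: "I \<subseteq> {0..int n - 1}"
begin

private lemma finite_I: "finite I"
  using I finite_subset by blast

private lemma sorted_list_n:
  "sorted (sorted_list_of_set I @ [int n])" "distinct (sorted_list_of_set I @ [int n])"
  "set (sorted_list_of_set I @ [int n]) \<subseteq> {0..int n}"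
  using I finite_I by (auto simp: sorted_append)

lemma elt_strict_less:
  assumes "1 \<le> s" "s < t" "t \<le> Suc (card I)"
  shows "elt n I s < elt n I t"
proof -
  have "sorted_wrt (<) (sorted_list_of_set I @ [int n])"
    using sorted_list_n by (simp only: strict_sorted_iff)
  then have "(sorted_list_of_set I @ [int n]) ! (s - 1) < (sorted_list_of_set I @ [int n]) ! (t - 1)"
    using assms by (intro sorted_wrt_nth_less[of "(<)"]) auto
  then show ?thesis
    using elt_conv_nth[of s I n] elt_conv_nth[of t I n] assms by simp
qed

lemma elt_bounds:
  assumes "1 \<le> t" "t \<le> Suc (card I)"
  shows "0 \<le> elt n I t" "elt n I t \<le> int n"
proof -
  have "elt n I t \<in> set (sorted_list_of_set I @ [int n])"
    using elt_conv_nth[of t I n] assms nth_mem[of "t - 1" "sorted_list_of_set I @ [int n]"]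
    by simp
  then show "0 \<le> elt n I t" "elt n I t \<le> int n"
    using sorted_list_n(3) by auto
qed

text \<open>All entries and n move together, so the gap product is unchanged. Only the factorials of
  n and of the first element each lose their top factor.\<close>

lemma fpol_lowered_0:
  assumes "I \<noteq> {}"
  shows "(1 - indet ^ n) * fpol (n - 1) (lowered n I 1) = (1 - indet ^ nat (elt n I 1)) * fpol n I"
proof -
  define xs where "xs = sorted_list_of_set I"
  have set: "set xs = I" and "xs \<noteq> []"
    using assms finite_I by (auto simp: xs_def)
  then obtain x ys where xs: "xs = x # ys"
    by (cases xs) auto
  have "x \<in> I"
    using set xs by auto
  then have "x \<ge> 0"
    using I by auto
  have elt: "elt n I 1 = x"
    using elt_conv_nth[of 1 I n] xs xs_def by simp
  have srt: "sorted xs" "distinct xs"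
    by (simp_all add: xs_def)
  define zs where "zs = map (\<lambda>x. x - 1) xs"
  have low: "lowered n I 1 = set zs"
    using lowered_Suc[OF finite_I, of 0 xs n] by (simp add: xs_def zs_def)
  have zs: "sorted zs" "zs \<noteq> []" "hd zs = x - 1"
    using sorted_lower_drop[OF srt, of 0] by (simp_all add: zs_def xs)
  have "zs @ [int (n - 1)] = map (\<lambda>x. x - 1) (xs @ [int n])"
    using n by (simp add: zs_def)
  then have gp: "gap_prod (zs @ [int (n - 1)]) = gap_prod (xs @ [int n])"
    by (simp only: gap_prod_map_minus)
  have f: "fpol n I = to_fract (qfact n) / to_fract (qfact (nat x) * gap_prod (xs @ [int n]))"
    using fpol_set_sorted[OF srt(1) \<open>xs \<noteq> []\<close>, of n] \<open>x \<ge> 0\<close> by (simp add: set) (simp add: xs)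
  show ?thesis
  proof (cases "x = 0")
    \<comment> \<open>The lowered set starts with -1, so its \<open>fpol\<close> is 0 by convention;
      on the other side the factor 1 - X^0 vanishes.\<close>
    case True
    then show ?thesis
      using fpol_set_sorted[OF zs(1,2), of "n - 1"] elt by (simp add: low[simplified] zs)
  next
    case False
    then obtain k where k: "nat x = Suc k" "nat (x - 1) = k"
      using \<open>x \<ge> 0\<close> by (cases "nat x") auto
    obtain m where m: "n = Suc m"
      using n by (cases n) auto
    have "fpol (n - 1) (lowered n I 1) =
        to_fract (qfact m) / to_fract (qfact k * gap_prod (xs @ [int n]))"
      using fpol_set_sorted[OF zs(1,2), of "n - 1"] False \<open>x \<ge> 0\<close> gp
      unfolding low by (simp add: zs k(2) m)
    moreover have "fpol n I = to_fract (qfact m) * (1 - indet ^ n) /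
        (to_fract (qfact k) * (1 - indet ^ Suc k) * to_fract (gap_prod (xs @ [int n])))"
      unfolding f by (simp only: k m qfact_Suc to_fract_mult to_fract_qint zero_less_Suc)
    moreover have "1 - indet ^ Suc k \<noteq> 0"
      using to_fract_qint[of "Suc k"] qint_nonzero[of "Suc k"] to_fract_eq_0_iff
      by (metis zero_less_Suc)
    ultimately show ?thesis
      unfolding elt k(1) by (simp del: power_Suc)
  qed
qed

text \<open>Cut the list between a = i_t and b = i_{t+1}. Nothing moves to the left and everything
  to the right, n included, moves by one, so among the gap factors only that of b - a changes. Its
  double factorial loses a factor exactly when the gap is even.\<close>

lemma fpol_lowered_Suc:
  assumes t: "1 \<le> t" "t \<le> card I"
  shows "(1 - indet ^ n) * fpol (n - 1) (lowered n I (Suc t)) =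
    (if even (gap n I t) then 1 - indet ^ nat (gap n I t) else 1) * fpol n I"
proof -
  define xs where "xs = sorted_list_of_set I"
  have set: "set xs = I" and len: "length xs = card I" and "xs \<noteq> []"
    using t finite_I by (auto simp: xs_def)
  have srt: "sorted xs" "distinct xs"
    by (simp_all add: xs_def)
  have "hd xs \<in> I"
    using set \<open>xs \<noteq> []\<close> by auto
  then have hd: "hd xs \<ge> 0"
    using I by auto
  \<comment> \<open>For t = \<open>card I\<close> the entry b is the appended n, so the list is
    split with n included.\<close>
  define us a b vs where "us = take (t - 1) xs" and "a = elt n I t" and "b = elt n I (Suc t)"
    and "vs = drop (Suc t) (xs @ [int n])"
  have a: "a = xs ! (t - 1)"
    using elt_conv_nth[of t I n] t by (auto simp: a_def xs_def nth_append)
  have b: "b = (xs @ [int n]) ! t"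
    using elt_conv_nth[of "Suc t" I n] t by (simp add: b_def xs_def)
  have take: "take t xs = us @ [a]"
    using take_Suc_conv_app_nth[of "t - 1" xs] t by (simp add: a us_def len)
  have drop: "drop t (xs @ [int n]) = b # vs"
    using Cons_nth_drop_Suc[of t "xs @ [int n]"] t len by (simp add: b vs_def)
  have split: "xs @ [int n] = us @ a # b # vs"
  proof -
    have "xs @ [int n] = take t (xs @ [int n]) @ drop t (xs @ [int n])"
      by (rule append_take_drop_id[symmetric])
    also have "take t (xs @ [int n]) = us @ [a]"
      using t len take by simp
    finally show ?thesis
      unfolding drop by simp
  qed
  define zs where "zs = take t xs @ map (\<lambda>x. x - 1) (drop t xs)"
  have low: "lowered n I (Suc t) = set zs"
    using lowered_Suc[OF finite_I, of t xs n] t by (simp add: xs_def zs_def)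
  \<comment> \<open>Since t >= 1, the first entry stays in place: it remains nonnegative and its
    factorial is unchanged.\<close>
  have zs: "sorted zs" "zs \<noteq> []" "hd zs = hd xs"
    using sorted_lower_drop[OF srt, of t] t \<open>xs \<noteq> []\<close> by (auto simp: zs_def hd_append)
  have "zs @ [int (n - 1)] = take t xs @ map (\<lambda>x. x - 1) (drop t (xs @ [int n]))"
    using n t len by (simp add: zs_def)
  also have "\<dots> = us @ a # (b - 1) # map (\<lambda>x. x - 1) vs"
    unfolding take drop by simp
  finally have "gap_prod (zs @ [int (n - 1)]) =
      gap_prod (us @ [a]) * qdfact (nat (b - 1 - a)) * gap_prod (map (\<lambda>x. x - 1) (b # vs))"
    by (simp only: gap_prod_append list.map)
  \<comment> \<open>The new gap b - 1 - a is k; the value k = 0 is the case of merging or, for t =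
    \<open>card I\<close>, of a last element equal to n - 1.\<close>
  moreover obtain k where k: "b - a = int (Suc k)"
    using elt_strict_less[of t "Suc t"] t unfolding a_def b_def
    by (metis zless_iff_Suc_zadd add_diff_cancel_left' le_refl lessI Suc_le_mono)
  ultimately have gz: "gap_prod (zs @ [int (n - 1)]) =
      gap_prod (us @ [a]) * qdfact k * gap_prod (b # vs)"
    by (simp only: gap_prod_map_minus) (simp add: algebra_simps)
  have gx: "gap_prod (xs @ [int n]) = gap_prod (us @ [a]) * qdfact (Suc k) * gap_prod (b # vs)"
    by (simp only: split gap_prod_append k nat_int)
  have gap: "gap n I t = int (Suc k)"
    using k by (simp add: gap_def a_def b_def)
  obtain m where m: "n = Suc m"
    using n by (cases n) auto
  define c where "c = (if even (Suc k) then 1 - indet ^ Suc k else 1)"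
  have c: "to_fract (qdfact (Suc k)) = to_fract (qdfact k) * c"
    unfolding qdfact_Suc to_fract_mult c_def by (simp add: to_fract_qint del: power_Suc)
  have "c \<noteq> 0"
    using c qdfact_nonzero[of "Suc k"] by (metis mult_zero_right to_fract_eq_0_iff)
  have "fpol n I = to_fract (qfact m) * (1 - indet ^ n) / (to_fract (qfact (nat (hd xs))) *
      (to_fract (gap_prod (us @ [a])) * (to_fract (qdfact k) * c) * to_fract (gap_prod (b # vs))))"
    using fpol_set_sorted[OF srt(1) \<open>xs \<noteq> []\<close>, of n] hd
    unfolding set gx by (simp add: c m qfact_Suc to_fract_qint del: power_Suc)
  moreover have "fpol (n - 1) (lowered n I (Suc t)) = to_fract (qfact m) /
      (to_fract (qfact (nat (hd xs))) *
      (to_fract (gap_prod (us @ [a])) * to_fract (qdfact k) * to_fract (gap_prod (b # vs))))"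
    using fpol_set_sorted[OF zs(1,2), of "n - 1"] hd gz unfolding low by (simp add: zs m)
  ultimately have "(1 - indet ^ n) * fpol (n - 1) (lowered n I (Suc t)) = c * fpol n I"
    using \<open>c \<noteq> 0\<close> by (simp add: mult_ac)
  moreover have "(if even (gap n I t) then 1 - indet ^ nat (gap n I t) else 1) = c"
    unfolding gap c_def by (simp only: nat_int even_of_nat)
  ultimately show ?thesis
    by simp
qed

section \<open>Telescoping sums and the two recurrences\<close>

lemma one_minus_indet_power_nonzero: "1 - indet ^ n \<noteq> 0"
  using n to_fract_qint[of n] qint_nonzero[of n]
  by (metis to_fract_eq_0_iff less_le_trans zero_less_one)

lemma fpol_lowered_even:
  assumes "1 \<le> t" "t \<le> card I" "even (gap n I t)"
  shows "(1 - indet ^ n) * (indet ^ nat (int n - elt n I (Suc t)) * fpol (n - 1) (lowered n I (Suc t)))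
    = (indet ^ nat (int n - elt n I (Suc t)) - indet ^ nat (int n - elt n I t)) * fpol n I"
proof -
  \<comment> \<open>Both summands on the right come from nonnegative integers, so \<open>nat\<close>
    respects the sum.\<close>
  have "nat (int n - elt n I t) = nat (int n - elt n I (Suc t)) + nat (gap n I t)"
    using elt_strict_less[of t "Suc t"] elt_bounds[of "Suc t"] assms(1,2) by (simp add: gap_def)
  then have "indet ^ nat (int n - elt n I (Suc t)) - indet ^ nat (int n - elt n I t) =
      indet ^ nat (int n - elt n I (Suc t)) * (1 - indet ^ nat (gap n I t))"
    by (simp add: power_add algebra_simps)
  then show ?thesis
    using fpol_lowered_Suc[OF assms(1,2)] assms(3) by (simp add: mult.left_commute)
qed

text \<open>The start s = \<open>Suc (card I)\<close> is allowed: the sum is then empty and the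
  right side is 0. This serves the odd case when the last gap is the odd one.\<close>

lemma sum_fpol_lowered_even:
  assumes "1 \<le> s" "s \<le> Suc (card I)" "\<And>t. s \<le> t \<Longrightarrow> t \<le> card I \<Longrightarrow> even (gap n I t)"
  shows "(1 - indet ^ n) * (\<Sum>t = s..card I.
      indet ^ nat (int n - elt n I (Suc t)) * fpol (n - 1) (lowered n I (Suc t)))
    = (1 - indet ^ nat (int n - elt n I s)) * fpol n I"
proof -
  have "(1 - indet ^ n) * (\<Sum>t = s..card I.
      indet ^ nat (int n - elt n I (Suc t)) * fpol (n - 1) (lowered n I (Suc t)))
    = (\<Sum>t = s..card I.
      (indet ^ nat (int n - elt n I (Suc t)) - indet ^ nat (int n - elt n I t)) * fpol n I)"
    unfolding sum_distrib_left using assms by (intro sum.cong fpol_lowered_even) auto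
  also have "\<dots> = (\<Sum>t = s..card I.
      indet ^ nat (int n - elt n I (Suc t)) - indet ^ nat (int n - elt n I t)) * fpol n I"
    by (simp add: sum_distrib_right)
  also have "\<dots> = (indet ^ nat (int n - elt n I (Suc (card I))) - indet ^ nat (int n - elt n I s)) * fpol n I"
    using assms by (subst sum_Suc_diff) simp_all
  \<comment> \<open>The upper end of the telescope thus has exponent 0 and gives the constant
    1.\<close>
  also have "elt n I (Suc (card I)) = int n"
    by (simp add: elt_def)
  finally show ?thesis
    by simp
qed

text \<open>After multiplication by 1 - X^n, the even gaps above m give 1 - X^(n - i_{m+1}) times f.
  The summand t = m restores the missing power because its gap is odd, and the extra term supplies
  -X^n.\<close>

lemma fpol_recurrence_odd:
  assumes m: "1 \<le> m" "m \<le> card I" "odd (gap n I m)"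
    and even: "\<And>t. m < t \<Longrightarrow> t \<le> card I \<Longrightarrow> even (gap n I t)"
  shows "fpol n I = - (indet ^ n) * fpol (n - 1) (lowered n I (Suc m)) +
    (\<Sum>t = m..card I. indet ^ nat (int n - elt n I (Suc t)) * fpol (n - 1) (lowered n I (Suc t)))"
    (is "_ = ?r + ?S")
proof -
  let ?g = "\<lambda>t. indet ^ nat (int n - elt n I (Suc t)) * fpol (n - 1) (lowered n I (Suc t))"
  have low: "(1 - indet ^ n) * fpol (n - 1) (lowered n I (Suc m)) = fpol n I"
    using fpol_lowered_Suc[OF m(1,2)] m(3) by simp
  have "(1 - indet ^ n) * (?r + ?S) = (1 - indet ^ n) * ?r + (1 - indet ^ n) * ?g m
      + (1 - indet ^ n) * (\<Sum>t = Suc m..card I. ?g t)"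
    using m by (simp add: sum.atLeast_Suc_atMost algebra_simps)
  also have "(1 - indet ^ n) * (\<Sum>t = Suc m..card I. ?g t)
      = (1 - indet ^ nat (int n - elt n I (Suc m))) * fpol n I"
    using m even by (intro sum_fpol_lowered_even) auto
  also have "(1 - indet ^ n) * ?r = - (indet ^ n) * fpol n I"
    using low by (simp add: mult.left_commute)
  also have "(1 - indet ^ n) * ?g m = indet ^ nat (int n - elt n I (Suc m)) * fpol n I"
    using low by (simp add: mult.left_commute)
  finally have "(1 - indet ^ n) * (?r + ?S) = (1 - indet ^ n) * fpol n I"
    by (simp add: algebra_simps)
  then show ?thesis
    using one_minus_indet_power_nonzero by simp
qed

text \<open>The sum from t = 1 gives 1 - X^(n - i_1) times f; the summand t = 0 contributes X^(n -
  i_1) - X^n, which completes the factor to 1 - X^n.\<close>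

lemma fpol_recurrence_even:
  assumes even: "\<And>t. 1 \<le> t \<Longrightarrow> t \<le> card I \<Longrightarrow> even (gap n I t)"
  shows "fpol n I =
    (\<Sum>t = 0..card I. indet ^ nat (int n - elt n I (Suc t)) * fpol (n - 1) (lowered n I (Suc t)))"
proof (cases "I = {}")
  \<comment> \<open>Only t = 0 occurs, with exponent n - n = 0, and both values of
    \<open>fpol\<close> are 1.\<close>
  case True
  then show ?thesis
    by (simp add: fpol_def lowered_def elt_def)
next
  case False
  let ?g = "\<lambda>t. indet ^ nat (int n - elt n I (Suc t)) * fpol (n - 1) (lowered n I (Suc t))"
  have "n = nat (int n - elt n I 1) + nat (elt n I 1)"
    using elt_bounds[of 1] by simp
  then have pow: "indet ^ nat (int n - elt n I 1) * indet ^ nat (elt n I 1) = indet ^ n"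
    by (metis power_add)
  have "(1 - indet ^ n) * (\<Sum>t = 0..card I. ?g t)
      = (1 - indet ^ n) * ?g 0 + (1 - indet ^ n) * (\<Sum>t = 1..card I. ?g t)"
    by (simp add: sum.atLeast_Suc_atMost algebra_simps)
  also have "(1 - indet ^ n) * (\<Sum>t = 1..card I. ?g t)
      = (1 - indet ^ nat (int n - elt n I 1)) * fpol n I"
    using even by (intro sum_fpol_lowered_even) auto
  also have "(1 - indet ^ n) * ?g 0
      = indet ^ nat (int n - elt n I 1) * ((1 - indet ^ nat (elt n I 1)) * fpol n I)"
    using fpol_lowered_0[OF False] by (simp add: mult.left_commute)
  also have "\<dots> = (indet ^ nat (int n - elt n I 1) - indet ^ n) * fpol n I"
    by (simp add: algebra_simps flip: pow)
  finally have "(1 - indet ^ n) * (\<Sum>t = 0..card I. ?g t) = (1 - indet ^ n) * fpol n I"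
    by (simp add: algebra_simps)
  then show ?thesis
    using one_minus_indet_power_nonzero by simp
qed

end

theorem theorem3p3:
  fixes n :: nat and I :: "int set"
  assumes "n \<ge> 1" and "I \<subseteq> {0..int n - 1}"
  shows "((\<exists>m \<in> {1..card I}. odd (gap n I m)) \<longrightarrow>
           (let m = Max {t \<in> {1..card I}. odd (gap n I t)} in
             fpol n I =
               - (indet ^ n) * fpol (n - 1) (lowered n I (m + 1)) +
               (\<Sum>t = m..card I.
                  indet ^ nat (int n - elt n I (t + 1)) * fpol (n - 1) (lowered n I (t + 1))))) \<and>
         (\<not> (\<exists>m \<in> {1..card I}. odd (gap n I m)) \<longrightarrow>
             fpol n I =
               (\<Sum>t = 0..card I.
                  indet ^ nat (int n - elt n I (t + 1)) * fpol (n - 1) (lowered n I (t + 1))))"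
proof (intro conjI impI)
  assume odd: "\<exists>m \<in> {1..card I}. odd (gap n I m)"
  define M where "M = {t \<in> {1..card I}. odd (gap n I t)}"
  define m where "m = Max M"
  have "finite M" "M \<noteq> {}"
    using odd by (auto simp: M_def)
  then have "m \<in> M" and max: "\<And>t. t \<in> M \<Longrightarrow> t \<le> m"
    by (simp_all add: m_def)
  then have m: "1 \<le> m" "m \<le> card I" "odd (gap n I m)"
    by (simp_all add: M_def)
  have "even (gap n I t)" if "m < t" "t \<le> card I" for t
    using that max[of t] m(1) unfolding M_def by fastforce
  then show "let m = Max {t \<in> {1..card I}. odd (gap n I t)} in
      fpol n I = - (indet ^ n) * fpol (n - 1) (lowered n I (m + 1)) +
        (\<Sum>t = m..card I.
          indet ^ nat (int n - elt n I (t + 1)) * fpol (n - 1) (lowered n I (t + 1)))"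
    unfolding M_def[symmetric] m_def[symmetric] Let_def Suc_eq_plus1[symmetric]
    by (intro fpol_recurrence_odd[OF assms] m)
next
  assume "\<not> (\<exists>m \<in> {1..card I}. odd (gap n I m))"
  then show "fpol n I = (\<Sum>t = 0..card I.
      indet ^ nat (int n - elt n I (t + 1)) * fpol (n - 1) (lowered n I (t + 1)))"
    using fpol_recurrence_even[OF assms] by simp
qed

end
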